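(* Let $q$ be a power of $2$, and let $L(x)=ax^q+bx$ with $a,b\in\mathbb F_{q^2}$. Let $\mathcal S(L)=\sum_{v\in\mathbb F_{q^2}}\chi(vL(v))$, where $\chi$ is the canonical additive character of $\mathbb F_{q^2}$. Then $\mathcal S(L)=0$ if and only if $a^q+a=0$ and $b\ne0$.
   Context: The canonical additive character of $\mathbb F_{q^2}$ ($q$ a power of $2$) is $\chi(v)=(-1)^{T(v)}$, where $T$ is the absolute trace map from $\mathbb F_{q^2}$ to $\mathbb F_2$. *)

theory Defs
  imports Complex_Main "HOL-Computational_Algebra.Primes" "HOL-Library.Cardinality"
begin

text \<open>The degree of a finite field over its prime field.\<close>

definition abs_degree :: "'a::finite_field itself \<Rightarrow> nat" where
  "abs_degree _ = (THE n. CARD('a) = CHAR('a) ^ n)"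

text \<open>
  The absolute trace is the sum of the conjugates of \<open>v\<close> over the prime field. The prime field is
  not a type of its own here; the trace takes its values in the prime subfield of \<open>'a\<close>.
\<close>

definition abs_trace :: "'a::finite_field \<Rightarrow> 'a" where
  "abs_trace v = (\<Sum>i<abs_degree TYPE('a). v ^ (CHAR('a) ^ i))"

text \<open>
  The canonical additive character, meaningful in characteristic 2 only: the exponent is the
  representative in \<open>{0, 1}\<close> of the trace.
\<close>

definition canonical_char :: "'a::finite_field \<Rightarrow> complex" where
  "canonical_char v = (-1) ^ (THE k::nat. k \<in> {0, 1} \<and> of_nat k = abs_trace v)"

definition char_sum :: "('a::finite_field \<Rightarrow> 'a) \<Rightarrow> complex" where
  "char_sum L = (\<Sum>v\<in>UNIV. canonical_char (v * L v))"

lemma CHAR_eq_2: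
  assumes "CARD('a::finite_field) = 2 ^ n"
  shows "CHAR('a) = 2"
proof -
  have "(\<Sum>x\<in>(UNIV::'a set). x + 1) = (\<Sum>x\<in>UNIV. x)"
    by (rule sum.reindex_bij_witness[of _ "\<lambda>x. x - 1" "\<lambda>x. x + 1"]) auto
  hence "of_nat CARD('a) = (0::'a)"
    by (simp add: sum.distrib)
  hence "CHAR('a) dvd 2 ^ n"
    unfolding assms of_nat_eq_0_iff_char_dvd .
  moreover have "prime CHAR('a)"
    by (rule prime_CHAR_semidom) (rule CHAR_pos)
  ultimately show ?thesis
    using prime_dvd_power primes_dvd_imp_eq two_is_prime_nat by blast
qed

lemma abs_degree_eq:
  assumes "CARD('a::finite_field) = 2 ^ n"
  shows "abs_degree TYPE('a) = n"
  unfolding abs_degree_def CHAR_eq_2[OF assms] assms by (rule the_equality) simp_all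

lemma abs_trace_eq:
  assumes "CARD('a::finite_field) = 2 ^ n"
  shows "abs_trace (v::'a) = (\<Sum>i<n. v ^ (2 ^ i))"
  by (simp add: abs_trace_def abs_degree_eq[OF assms] CHAR_eq_2[OF assms])

lemma abs_trace_in_prime_field:
  assumes "CARD('a::finite_field) = 2 ^ n"
  shows "abs_trace (v::'a) \<in> {0, 1}"
proof -
  let ?T = "abs_trace v"
  have "?T ^ 2 = (\<Sum>i<n. (v ^ (2 ^ i)) ^ 2)"
    unfolding abs_trace_eq[OF assms] using freshmans_dream_sum[where 'a = 'a]
    by (metis CHAR_eq_2[OF assms] two_is_prime_nat)
  also have "\<dots> = (\<Sum>i<n. v ^ (2 ^ Suc i))"
    by (simp add: power_mult[symmetric] mult.commute)
  finally have "?T ^ 2 + v = (\<Sum>i<Suc n. v ^ (2 ^ i))"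
    unfolding sum.lessThan_Suc_shift by simp
  also have "\<dots> = ?T + v"
    using finite_field_power_card_eq_same[of v] assms by (simp add: abs_trace_eq[OF assms])
  finally have "?T * (?T - 1) = 0"
    by (simp add: power2_eq_square algebra_simps)
  thus ?thesis by auto
qed

lemma canonical_char_eq:
  assumes "CARD('a::finite_field) = 2 ^ n"
  shows "canonical_char (v::'a) = (if abs_trace v = 0 then 1 else -1)"
proof -
  have "(THE k::nat. k \<in> {0, 1} \<and> of_nat k = abs_trace v) = (if abs_trace v = 0 then 0 else 1)"
    using abs_trace_in_prime_field[OF assms, of v] by (intro the_equality) auto
  thus ?thesis by (simp add: canonical_char_def)
qed

end

theory Submission
  imports Defs "HOL-Computational_Algebra.Polynomial"
begin

text \<open>
  Write \<open>S\<close> for the sum. Expanding \<open>S\<^sup>2\<close> and using that \<open>\<chi>\<close> is invariant under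
  \<open>x \<mapsto> x\<^sup>q\<close> turns the cross terms into \<open>\<chi>((a\<^sup>q + a) v\<^sup>q w)\<close>. If \<open>a\<^sup>q + a \<noteq> 0\<close>,
  orthogonality leaves only \<open>v = 0\<close>, so \<open>S\<^sup>2 = q\<^sup>2\<close>. If \<open>a\<^sup>q + a = 0\<close>, then
  \<open>a v\<^bsup>q+1\<^esup>\<close> lies in the subfield with \<open>q\<close> elements, on which the absolute trace
  of the larger field vanishes, and \<open>S\<close> is the sum of the additive character \<open>\<chi>(b u)\<close> over the squares
  \<open>u = v\<^sup>2\<close>, which are all elements of the field.
\<close>

lemma add_self_eq_0:
  assumes "CARD('a::finite_field) = 2 ^ n"
  shows "x + x = (0::'a)"
proof -
  have "of_nat CHAR('a) = (0::'a)" by (rule of_nat_CHAR)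
  hence "(2::'a) = 0" by (simp add: CHAR_eq_2[OF assms])
  thus ?thesis by (metis mult_2 mult_zero_left)
qed

lemma power_2_power_add:
  assumes "CARD('a::finite_field) = 2 ^ n"
  shows "(x + y :: 'a) ^ (2 ^ k) = x ^ (2 ^ k) + y ^ (2 ^ k)"
  using freshmans_dream'[where 'a = 'a and x = x and y = y and m = "2 ^ k" and n = k]
  by (simp add: CHAR_eq_2[OF assms])

lemma abs_trace_add:
  assumes "CARD('a::finite_field) = 2 ^ n"
  shows "abs_trace (x + y :: 'a) = abs_trace x + abs_trace y"
  by (simp add: abs_trace_eq[OF assms] power_2_power_add[OF assms] sum.distrib)

text \<open>Squaring shifts the list of conjugates by one place, and the shift is cyclic because
  \<open>x ^ (2 ^ n) = x\<close>.\<close>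

lemma abs_trace_square:
  assumes "CARD('a::finite_field) = 2 ^ n"
  shows "abs_trace (x ^ 2 :: 'a) = abs_trace x"
proof -
  have "abs_trace (x ^ 2) + x = (\<Sum>i<Suc n. x ^ (2 ^ i))"
    unfolding sum.lessThan_Suc_shift
    by (simp add: abs_trace_eq[OF assms] power_mult[symmetric])
  also have "\<dots> = abs_trace x + x"
    using finite_field_power_card_eq_same[of x] assms by (simp add: abs_trace_eq[OF assms])
  finally show ?thesis by simp
qed

lemma abs_trace_power_2_power:
  assumes "CARD('a::finite_field) = 2 ^ n"
  shows "abs_trace (x ^ (2 ^ k) :: 'a) = abs_trace x"
proof (induction k)
  case (Suc k)
  have "x ^ (2 ^ Suc k) = (x ^ (2 ^ k)) ^ 2"
    by (simp add: power_mult[symmetric] mult.commute)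
  with Suc show ?case by (simp only: abs_trace_square[OF assms])
qed simp

text \<open>The conjugates of \<open>y\<close> repeat with period \<open>m\<close>, so the trace is
  a sum added to itself, which is zero in characteristic 2.\<close>

lemma abs_trace_eq_0_if_in_subfield:
  assumes "CARD('a::finite_field) = 2 ^ (2 * m)" and "y ^ (2 ^ m) = (y::'a)"
  shows "abs_trace y = 0"
proof -
  let ?s = "\<Sum>i<m. y ^ (2 ^ i)"
  have "(\<Sum>i<m + m. y ^ (2 ^ i)) = ?s + (\<Sum>i<m. y ^ (2 ^ (m + i)))"
    by (simp add: sum.nat_group[symmetric] lessThan_atLeast0 sum.atLeastLessThan_concat[symmetric, of 0 m "m + m"]
        sum.shift_bounds_nat_ivl[of _ 0 m m, simplified] add.commute)
  also have "(\<Sum>i<m. y ^ (2 ^ (m + i))) = ?s"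
    by (simp add: power_add power_mult assms(2))
  finally show ?thesis
    by (simp add: abs_trace_eq[OF assms(1)] mult_2 add_self_eq_0[OF assms(1)])
qed

text \<open>The trace is a polynomial function of degree at most \<open>2 ^ (n - 1)\<close>, too
  small for every field element to be a root.\<close>

lemma exists_abs_trace_nonzero:
  assumes "CARD('a::finite_field) = 2 ^ n"
  shows "\<exists>x::'a. abs_trace x \<noteq> 0"
proof (rule ccontr)
  assume all: "\<not> ?thesis"
  have "CARD('a) \<noteq> 1"
    by (metis card_1_singletonE UNIV_I singletonD zero_neq_one)
  then obtain k where n: "n = Suc k"
    using assms by (cases n) auto
  define p :: "'a poly" where "p = (\<Sum>i<n. monom 1 (2 ^ i))"
  have "poly p x = 0" for x
    using all by (simp add: p_def poly_sum poly_monom abs_trace_eq[OF assms])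
  \<comment> \<open>Only the summand \<open>i = 0\<close> has exponent 1; it is present because
    \<open>n > 0\<close>.\<close>
  moreover have "coeff p 1 = 1"
  proof -
    have "coeff p 1 = (\<Sum>i<n. if i = 0 then 1 else 0)"
      unfolding p_def coeff_sum by (intro sum.cong) auto
    thus ?thesis by (simp add: n)
  qed
  hence "p \<noteq> 0" by auto
  moreover have "degree p \<le> 2 ^ k"
    unfolding p_def
    by (intro degree_sum_le) (auto intro!: order.trans[OF degree_monom_le] simp: n less_Suc_eq_le)
  ultimately have "CARD('a) \<le> 2 ^ k"
    using card_poly_roots_bound[of p] by simp
  thus False by (simp add: assms n)
qed

lemma canonical_char_add:
  assumes "CARD('a::finite_field) = 2 ^ n"
  shows "canonical_char (x + y :: 'a) = canonical_char x * canonical_char y"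
  using abs_trace_in_prime_field[OF assms, of x] abs_trace_in_prime_field[OF assms, of y]
  by (auto simp: canonical_char_eq[OF assms] abs_trace_add[OF assms] add_self_eq_0[OF assms])

lemma sum_canonical_char_mult:
  assumes "CARD('a::finite_field) = 2 ^ n"
  shows "(\<Sum>w\<in>UNIV. canonical_char (c * w :: 'a)) = (if c = 0 then of_nat CARD('a) else 0)"
proof (cases "c = 0")
  case True
  thus ?thesis
    by (simp add: canonical_char_eq[OF assms] abs_trace_eq[OF assms] power_0_left)
next
  case False
  obtain x :: 'a where x: "abs_trace x \<noteq> 0"
    using exists_abs_trace_nonzero[OF assms] by blast
  let ?S = "\<Sum>w\<in>UNIV. canonical_char (c * w)"
  \<comment> \<open>The shift is chosen so that every term gains the factor
    \<open>canonical_char x = -1\<close>.\<close>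
  have "?S = (\<Sum>w\<in>UNIV. canonical_char (c * (w + x / c)))"
    by (rule sum.reindex_bij_witness[of _ "\<lambda>w. w + x / c" "\<lambda>w. w - x / c"]) auto
  also have "\<dots> = - ?S"
    using x False
    by (simp add: distrib_left canonical_char_add[OF assms] canonical_char_eq[OF assms, of x]
        sum_negf)
  finally show ?thesis using False by simp
qed

lemma sum_canonical_char_square:
  assumes "CARD('a::finite_field) = 2 ^ n"
  shows "(\<Sum>v\<in>UNIV. canonical_char (b * v ^ 2 :: 'a)) = (\<Sum>u\<in>UNIV. canonical_char (b * u))"
proof -
  have "inj (\<lambda>v::'a. v ^ 2)"
  proof (rule injI)
    fix v w :: 'a
    assume "v ^ 2 = w ^ 2"
    hence "(v + w) ^ 2 = 0"
      using power_2_power_add[OF assms, of v w 1] by (simp add: add_self_eq_0[OF assms])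
    hence "v + w = w + w" by (simp add: add_self_eq_0[OF assms])
    thus "v = w" by simp
  qed
  hence "bij (\<lambda>v::'a. v ^ 2)"
    by (simp add: bij_def finite_UNIV_inj_surj)
  thus ?thesis by (rule sum.reindex_bij_betw)
qed

text \<open>The map \<open>v * L v\<close> is a quadratic form. Replacing \<open>v\<close> by
  \<open>v + w\<close> in one factor of the square leaves its polar form, which Frobenius invariance
  makes linear in \<open>w\<close> inside the character.\<close>

lemma char_sum_square:
  fixes a b :: "'a::finite_field"
  assumes "CARD('a) = 2 ^ (2 * m)"
  defines "L \<equiv> \<lambda>x. a * x ^ (2 ^ m) + b * x"
  shows "(char_sum L)\<^sup>2 =
    (\<Sum>v\<in>UNIV. canonical_char (v * L v) *
      (\<Sum>w\<in>UNIV. canonical_char ((a ^ (2 ^ m) + a) * v ^ (2 ^ m) * w)))"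
proof -
  let ?q = "2 ^ m :: nat" and ?\<chi> = "canonical_char :: 'a \<Rightarrow> complex"
  note add = canonical_char_add[OF assms(1)]
  have \<chi>_sq: "?\<chi> x * ?\<chi> x = 1" for x
    by (simp add: canonical_char_eq[OF assms(1)])
  have \<chi>_q: "?\<chi> (x ^ ?q) = ?\<chi> x" for x
    by (simp only: canonical_char_eq[OF assms(1)] abs_trace_power_2_power[OF assms(1)])
  have q_q: "(x ^ ?q) ^ ?q = x" for x :: 'a
    using finite_field_power_card_eq_same[of x]
    by (simp add: assms(1) power_mult[symmetric] power_add[symmetric] mult_2)
  have cross: "?\<chi> (w * L w) * ?\<chi> ((v + w) * L (v + w)) =
      ?\<chi> (v * L v) * ?\<chi> ((a ^ ?q + a) * v ^ ?q * w)" for v w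
  proof -
    have "(v + w) * L (v + w) =
        w * L w + (v * L v + (a * v ^ ?q * w + a * v * w ^ ?q + (b * v * w + b * v * w)))"
      unfolding L_def power_2_power_add[OF assms(1)] by (simp add: algebra_simps)
    also have "b * v * w + b * v * w = 0"
      by (rule add_self_eq_0[OF assms(1)])
    finally have "?\<chi> ((v + w) * L (v + w)) =
        ?\<chi> (w * L w) * (?\<chi> (v * L v) * (?\<chi> (a * v ^ ?q * w) * ?\<chi> (a * v * w ^ ?q)))"
      by (simp only: add add_0_right)
    \<comment> \<open>The \<open>?q\<close>-th power is an involution, so it moves the exponent from
      \<open>w\<close> to \<open>a\<close> and \<open>v\<close>.\<close>
    also have "?\<chi> (a * v * w ^ ?q) = ?\<chi> (a ^ ?q * v ^ ?q * w)"
      using \<chi>_q[of "a * v * w ^ ?q"] by (simp only: power_mult_distrib q_q)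
    also have "?\<chi> (a * v ^ ?q * w) * \<dots> = ?\<chi> ((a ^ ?q + a) * v ^ ?q * w)"
      by (simp only: add[symmetric]) (simp add: algebra_simps)
    finally show ?thesis
      by (simp only: mult.assoc[symmetric] \<chi>_sq mult_1)
  qed
  have "(char_sum L)\<^sup>2 = (\<Sum>w\<in>UNIV. \<Sum>v\<in>UNIV. ?\<chi> (w * L w) * ?\<chi> (v * L v))"
    by (simp add: char_sum_def power2_eq_square sum_product)
  also have "\<dots> = (\<Sum>w\<in>UNIV. \<Sum>v\<in>UNIV. ?\<chi> (w * L w) * ?\<chi> ((v + w) * L (v + w)))"
  proof (rule sum.cong[OF refl])
    fix w :: 'a
    show "(\<Sum>v\<in>UNIV. ?\<chi> (w * L w) * ?\<chi> (v * L v)) =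
        (\<Sum>v\<in>UNIV. ?\<chi> (w * L w) * ?\<chi> ((v + w) * L (v + w)))"
      by (rule sum.reindex_bij_witness[of _ "\<lambda>v. v + w" "\<lambda>v. v - w"]) auto
  qed
  \<comment> \<open>The swap makes \<open>w\<close> the inner variable, ready for
    orthogonality.\<close>
  also have "\<dots> = (\<Sum>v\<in>UNIV. \<Sum>w\<in>UNIV. ?\<chi> (v * L v) * ?\<chi> ((a ^ ?q + a) * v ^ ?q * w))"
    by (subst sum.swap) (simp only: cross)
  finally show ?thesis by (simp only: sum_distrib_left)
qed

theorem theorem4:
  fixes q m :: nat and a b :: "'a::finite_field" and L :: "'a \<Rightarrow> 'a"
  assumes "q = 2 ^ m"
    and "CARD('a) = q\<^sup>2"
    and "L = (\<lambda>x. a * x ^ q + b * x)"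
  shows "char_sum L = 0 \<longleftrightarrow> a ^ q + a = 0 \<and> b \<noteq> 0"
proof -
  have card: "CARD('a) = 2 ^ (2 * m)"
    using assms(1,2) by (simp add: power_mult[symmetric] mult.commute)
  show ?thesis
  proof (cases "a ^ q + a = 0")
    case False
    have "(char_sum L)\<^sup>2 =
        (\<Sum>v\<in>UNIV. canonical_char (v * L v) * (if v = 0 then of_nat CARD('a) else 0))"
      using char_sum_square[OF card, of a b] False
      unfolding assms(1,3) sum_canonical_char_mult[OF card] by simp
    also have "\<dots> = of_nat CARD('a)"
      by (simp add: if_distrib[of "\<lambda>x. _ * x"] canonical_char_eq[OF card] abs_trace_eq[OF card]
          power_0_left cong: if_cong)
    finally have "char_sum L \<noteq> 0" by auto
    with False show ?thesis by simp
  next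
    case True
    hence a: "a ^ q = a"
      using add_self_eq_0[OF card, of a] by (metis add_right_cancel)
    have "canonical_char (v * L v) = canonical_char (b * v ^ 2)" for v
    proof -
      have "(v ^ q) ^ q = v"
        using finite_field_power_card_eq_same[of v] assms(2)
        by (simp add: power_mult[symmetric] power2_eq_square)
      \<comment> \<open>The \<open>q\<close>-th power swaps the two factors of the norm
        \<open>v * v ^ q\<close> and fixes \<open>a\<close>.\<close>
      hence "(a * (v * v ^ q)) ^ q = a * (v * v ^ q)"
        by (simp add: power_mult_distrib a mult.commute)
      hence "abs_trace (a * (v * v ^ q)) = 0"
        unfolding assms(1) by (rule abs_trace_eq_0_if_in_subfield[OF card])
      moreover have "v * L v = a * (v * v ^ q) + b * v ^ 2"
        by (simp add: assms(3) algebra_simps power2_eq_square)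
      ultimately show ?thesis
        by (simp add: canonical_char_eq[OF card] abs_trace_add[OF card])
    qed
    hence "char_sum L = (if b = 0 then of_nat CARD('a) else 0)"
      by (simp add: char_sum_def sum_canonical_char_square[OF card]
          sum_canonical_char_mult[OF card])
    with True show ?thesis by simp
  qed
qed

end
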